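(* For every $1\le p<\infty$, there exists a holomorphic function $f\in\mathcal H(\ell_1;\ell_p)$ such that for all $m\in\mathbb N$, $P_mf(0)$ is $p$-compact, but $f$ is not $p$-compact at $0$. Furthermore, $f$ can be chosen so that every polynomial $P_mf(y)$ in the Taylor series expansion of $f$ at any $y\in\ell_1$ is $1$-compact, and therefore $r$-compact for all $1\le r<\infty$, but $f$ is not $p$-compact at any $y\in\ell_1$.
   Context: Spaces are complex; $B_E$ is the closed unit ball of $E$. $\mathcal H(E;F)$ is the space of entire functions $f:E\to F$ between Banach spaces; for $y\in E$, $P_mf(y)$ are the continuous $m$-homogeneous polynomials from $E$ to $F$ such that $f(x)=\sum_{m\ge0}P_mf(y)(x-y)$ uniformly for $x$ in some neighborhood of $y$. $\ell_p(F)$ is the Banach space of $p$-summable sequences in $F$. For $1\le p<\infty$, $\frac1p+\frac1q=1$, and $(y_n)_n\in\ell_p(F)$, put $p\text{-co}\{y_n\}=\{\sum_n\alpha_ny_n:(\alpha_n)_n\in B_{\ell_q}\}$. A set $K\subset F$ is relatively $p$-compact if it is contained in the closure of $p\text{-co}\{y_n\}$ for some $(y_n)_n\in\ell_p(F)$. A continuous homogeneous polynomial $P:E\to F$ is $p$-compact if $P(B_E)$ is relatively $p$-compact. A function $f\in\mathcal H(E;F)$ is $p$-compact at $x_0$ if there is a neighborhood $V$ of $x_0$ such that $f(V)$ is relatively $p$-compact in $F$. *)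

theory Defs
  imports "HOL-Analysis.Analysis" "HOL-Library.Function_Algebras"
begin

section \<open>Complex normed spaces on explicit carriers\<close>

text \<open>
  The exponent of a sequence space is a real parameter, so the spaces cannot be types.  A normed
  space is a set \<open>car\<close> inside an ambient additive group, with scalar multiplication \<open>scl\<close> and norm
  \<open>nrm\<close>; only the behaviour on \<open>car\<close> matters.
\<close>

record 'a cnspace =
  car :: "'a set"
  scl :: "complex \<Rightarrow> 'a \<Rightarrow> 'a"
  nrm :: "'a \<Rightarrow> real"

definition ndist :: "('a::ab_group_add) cnspace \<Rightarrow> 'a \<Rightarrow> 'a \<Rightarrow> real" where
  "ndist E x y = nrm E (x - y)"

definition ntop :: "('a::ab_group_add) cnspace \<Rightarrow> 'a topology" where
  "ntop E = Metric_space.mtopology (car E) (ndist E)"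

definition nball :: "('a::ab_group_add) cnspace \<Rightarrow> 'a set" where
  "nball E = {x \<in> car E. nrm E x \<le> 1}"

definition neighborhood :: "('a::ab_group_add) cnspace \<Rightarrow> 'a \<Rightarrow> 'a set \<Rightarrow> bool" where
  "neighborhood E x V \<longleftrightarrow> V \<subseteq> car E \<and> (\<exists>U. openin (ntop E) U \<and> x \<in> U \<and> U \<subseteq> V)"


section \<open>Sequence spaces\<close>

definition ell :: "ennreal \<Rightarrow> (nat \<Rightarrow> complex) cnspace" where
  "ell p =
    \<lparr> car = {x. if p = \<infinity> then bounded (range x) else summable (\<lambda>n. norm (x n) powr enn2real p)},
      scl = (\<lambda>c x n. c * x n),
      nrm = (\<lambda>x. if p = \<infinity> then (SUP n. norm (x n))
                 else (\<Sum>n. norm (x n) powr enn2real p) powr (1 / enn2real p)) \<rparr>"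

definition ell_seq :: "real \<Rightarrow> ('a::ab_group_add) cnspace \<Rightarrow> (nat \<Rightarrow> 'a) set" where
  "ell_seq p F = {y. (\<forall>n. y n \<in> car F) \<and> summable (\<lambda>n. nrm F (y n) powr p)}"


section \<open>Relatively $p$-compact sets\<close>

text \<open>
  The equation \<open>1/p + 1/q = 1\<close> is read in the extended nonnegative reals, where \<open>1/\<infinity> = 0\<close>;
  so \<open>q = \<infinity>\<close> for \<open>p = 1\<close>.
\<close>

definition p_co :: "real \<Rightarrow> ('a::ab_group_add) cnspace \<Rightarrow> (nat \<Rightarrow> 'a) \<Rightarrow> 'a set" where
  "p_co p F y = {s. \<exists>q \<alpha>. 1 / ennreal p + 1 / q = 1 \<and> \<alpha> \<in> nball (ell q) \<and>
     limitin (ntop F) (\<lambda>N. \<Sum>n<N. scl F (\<alpha> n) (y n)) s sequentially}"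

definition rel_p_compact :: "real \<Rightarrow> ('a::ab_group_add) cnspace \<Rightarrow> 'a set \<Rightarrow> bool" where
  "rel_p_compact p F K \<longleftrightarrow> (\<exists>y \<in> ell_seq p F. K \<subseteq> ntop F closure_of p_co p F y)"


section \<open>Homogeneous polynomials and entire functions\<close>

definition multilinear ::
  "('a::ab_group_add) cnspace \<Rightarrow> ('b::ab_group_add) cnspace \<Rightarrow> nat \<Rightarrow> ((nat \<Rightarrow> 'a) \<Rightarrow> 'b) \<Rightarrow> bool"
where
  "multilinear E F m A \<longleftrightarrow>
     A \<in> ({..<m} \<rightarrow>\<^sub>E car E) \<rightarrow> car F \<and>
     (\<forall>x \<in> {..<m} \<rightarrow>\<^sub>E car E. \<forall>i<m. \<forall>u \<in> car E. \<forall>v \<in> car E. \<forall>c.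
        A (x(i := u + v)) = A (x(i := u)) + A (x(i := v)) \<and>
        A (x(i := scl E c u)) = scl F c (A (x(i := u))))"

definition cont_hom_poly ::
  "('a::ab_group_add) cnspace \<Rightarrow> ('b::ab_group_add) cnspace \<Rightarrow> nat \<Rightarrow> ('a \<Rightarrow> 'b) \<Rightarrow> bool"
where
  "cont_hom_poly E F m P \<longleftrightarrow>
     (\<exists>A. multilinear E F m A \<and> (\<forall>x \<in> car E. P x = A (\<lambda>i\<in>{..<m}. x))) \<and>
     continuous_map (ntop E) (ntop F) P"

definition taylor_expansion ::
  "('a::ab_group_add) cnspace \<Rightarrow> ('b::ab_group_add) cnspace \<Rightarrow> ('a \<Rightarrow> 'b) \<Rightarrow> 'a \<Rightarrow>
   (nat \<Rightarrow> 'a \<Rightarrow> 'b) \<Rightarrow> bool"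
where
  "taylor_expansion E F f y P \<longleftrightarrow>
     (\<forall>m. cont_hom_poly E F m (P m)) \<and>
     (\<exists>V. neighborhood E y V \<and>
        (\<forall>\<epsilon>>0. \<exists>N. \<forall>n\<ge>N. \<forall>x\<in>V. nrm F (f x - (\<Sum>m<n. P m (x - y))) < \<epsilon>))"

definition entire ::
  "('a::ab_group_add) cnspace \<Rightarrow> ('b::ab_group_add) cnspace \<Rightarrow> ('a \<Rightarrow> 'b) \<Rightarrow> bool"
where
  "entire E F f \<longleftrightarrow> f \<in> car E \<rightarrow> car F \<and> (\<forall>y \<in> car E. \<exists>P. taylor_expansion E F f y P)"

text \<open>
  The polynomials of a Taylor expansion are uniquely determined on \<open>car E\<close>, so the choice below
  only concerns irrelevant values outside the carrier.
\<close>

definition taylor_poly ::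
  "('a::ab_group_add) cnspace \<Rightarrow> ('b::ab_group_add) cnspace \<Rightarrow> nat \<Rightarrow> ('a \<Rightarrow> 'b) \<Rightarrow> 'a \<Rightarrow> 'a \<Rightarrow> 'b"
where
  "taylor_poly E F m f y = (SOME P. taylor_expansion E F f y P) m"

definition p_compact_poly ::
  "real \<Rightarrow> ('a::ab_group_add) cnspace \<Rightarrow> ('b::ab_group_add) cnspace \<Rightarrow> ('a \<Rightarrow> 'b) \<Rightarrow> bool"
where
  "p_compact_poly p E F P \<longleftrightarrow> (\<exists>m. cont_hom_poly E F m P) \<and> rel_p_compact p F (P ` nball E)"

definition p_compact_at ::
  "real \<Rightarrow> ('a::ab_group_add) cnspace \<Rightarrow> ('b::ab_group_add) cnspace \<Rightarrow> ('a \<Rightarrow> 'b) \<Rightarrow> 'a \<Rightarrow> bool"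
where
  "p_compact_at p E F f x\<^sub>0 \<longleftrightarrow> (\<exists>V. neighborhood E x\<^sub>0 V \<and> rel_p_compact p F (f ` V))"


section \<open>The norm topology of the sequence spaces\<close>

lemma powr_convex_nonneg:
  fixes u v s t p :: real
  assumes "1 \<le> p" "0 \<le> u" "0 \<le> v" "0 \<le> s" "0 \<le> t" "s + t = 1"
  shows "(s * u + t * v) powr p \<le> s * u powr p + t * v powr p"
proof -
  have le: "r powr p \<le> r" if "0 \<le> r" "r \<le> 1" for r :: real
    using powr_mono'[of 1 p r] that assms(1) by (cases "r = 0") auto
  consider "u = 0" | "v = 0" | "0 < u" "0 < v"
    using assms by linarith
  then show ?thesis
  proof cases
    case 1
    then show ?thesis
      using assms le[of t] by (simp add: powr_mult mult_right_mono)
  next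
    case 2
    then show ?thesis
      using assms le[of s] by (simp add: powr_mult mult_right_mono)
  next
    case 3
    have s: "s = 1 - t" using assms by simp
    from 3 show ?thesis
      using convex_onD[OF powr_convex[OF assms(1)], of t u v] assms
      by (simp add: s)
  qed
qed

lemma minkowski_powr:
  fixes x y :: "nat \<Rightarrow> complex"
  assumes p: "1 \<le> p"
    and x: "summable (\<lambda>n. norm (x n) powr p)" and y: "summable (\<lambda>n. norm (y n) powr p)"
  shows "summable (\<lambda>n. norm (x n + y n) powr p)"
    and "(\<Sum>n. norm (x n + y n) powr p) powr (1/p)
          \<le> (\<Sum>n. norm (x n) powr p) powr (1/p) + (\<Sum>n. norm (y n) powr p) powr (1/p)"
proof -
  let ?A = "\<Sum>n. norm (x n) powr p" and ?B = "\<Sum>n. norm (y n) powr p"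
  define a b where "a = ?A powr (1/p)" and "b = ?B powr (1/p)"
  have AB: "0 \<le> ?A" "0 \<le> ?B"
    by (simp_all add: suminf_nonneg x y)
  have ap: "a powr p = ?A" "b powr p = ?B" "0 \<le> a" "0 \<le> b"
    using p AB by (simp_all add: a_def b_def powr_powr)
  have main: "summable (\<lambda>n. norm (x n + y n) powr p) \<and>
      (\<Sum>n. norm (x n + y n) powr p) \<le> (a + b) powr p"
  proof -
    consider "a = 0" | "b = 0" | "0 < a" "0 < b"
      using ap by linarith
    then show ?thesis
    proof cases
      case 1
      then have "?A = 0" using ap p by auto
      then have "\<forall>n. norm (x n) powr p = 0"
        using suminf_eq_zero_iff[OF x] by simp
      then show ?thesis using 1 y ap by simp
    next
      case 2
      then have "?B = 0" using ap p by auto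
      then have "\<forall>n. norm (y n) powr p = 0"
        using suminf_eq_zero_iff[OF y] by simp
      then show ?thesis using 2 x ap by simp
    next
      case 3
      define s t where "s = a / (a + b)" and "t = b / (a + b)"
      have st: "0 \<le> s" "0 \<le> t" "s + t = 1"
        using 3 by (auto simp: s_def t_def add_divide_distrib[symmetric])
      let ?g = "\<lambda>n. (a + b) powr p *
        (s * (norm (x n) powr p / ?A) + t * (norm (y n) powr p / ?B))"
      have bound: "norm (x n + y n) powr p \<le> ?g n" for n
      proof -
        have "norm (x n + y n) powr p \<le> (norm (x n) + norm (y n)) powr p"
          using p by (intro powr_mono2) (auto simp: norm_triangle_ineq)
        also have "norm (x n) + norm (y n) =
            (a + b) * (s * (norm (x n) / a) + t * (norm (y n) / b))"
          using 3 by (simp add: s_def t_def distrib_left)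
        also have "\<dots> powr p = (a + b) powr p * (s * (norm (x n) / a) + t * (norm (y n) / b)) powr p"
          using 3 st by (intro powr_mult)
        also have "\<dots> \<le> (a + b) powr p *
            (s * (norm (x n) / a) powr p + t * (norm (y n) / b) powr p)"
          using 3 st p by (intro mult_left_mono powr_convex_nonneg) auto
        also have "\<dots> = ?g n"
          using 3 ap by (simp add: powr_divide)
        finally show ?thesis .
      qed
      have pos: "?A \<noteq> 0" "?B \<noteq> 0"
        using 3 ap p by auto
      have "(\<lambda>n. s * (norm (x n) powr p / ?A) + t * (norm (y n) powr p / ?B))
          sums (s * (?A / ?A) + t * (?B / ?B))"
        by (intro sums_add sums_mult sums_divide summable_sums x y)
      then have "?g sums ((a + b) powr p * 1)"
        using pos st by (intro sums_mult) simp
      then have g: "summable ?g" "suminf ?g = (a + b) powr p"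
        by (simp_all add: sums_iff)
      have sm: "summable (\<lambda>n. norm (x n + y n) powr p)"
        by (rule summable_comparison_test'[OF g(1), of 0]) (use bound in simp)
      with suminf_le[OF bound sm g(1)] g(2) show ?thesis by simp
    qed
  qed
  then show sm: "summable (\<lambda>n. norm (x n + y n) powr p)" by simp
  have "(\<Sum>n. norm (x n + y n) powr p) powr (1/p) \<le> ((a + b) powr p) powr (1/p)"
    using main p by (intro powr_mono2 suminf_nonneg sm) auto
  also have "\<dots> = a + b"
    using ap p by (simp add: powr_powr)
  finally show "(\<Sum>n. norm (x n + y n) powr p) powr (1/p) \<le> ?A powr (1/p) + ?B powr (1/p)"
    by (simp add: a_def b_def)
qed

lemma Metric_space_ell:
  fixes p :: real
  assumes p: "1 \<le> p"
  shows "Metric_space (car (ell (ennreal p))) (ndist (ell (ennreal p)))"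
proof
  have diff: "summable (\<lambda>n. norm (x n - y n) powr p)"
    if "summable (\<lambda>n. norm (x n) powr p)" "summable (\<lambda>n. norm (y n) powr p)"
    for x y :: "nat \<Rightarrow> complex"
    using minkowski_powr(1)[OF p that(1), of "\<lambda>n. - y n"] that(2) by simp
  fix x y z
  show "0 \<le> ndist (ell (ennreal p)) x y"
    by (simp add: ndist_def ell_def)
  show "ndist (ell (ennreal p)) x y = ndist (ell (ennreal p)) y x"
    by (simp add: ndist_def ell_def norm_minus_commute)
  assume x: "x \<in> car (ell (ennreal p))" and y: "y \<in> car (ell (ennreal p))"
  have "ndist (ell (ennreal p)) x y = 0 \<longleftrightarrow> (\<forall>n. norm (x n - y n) powr p = 0)"
    using x y p suminf_eq_zero_iff[OF diff[of x y]] by (simp add: ndist_def ell_def)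
  then show "ndist (ell (ennreal p)) x y = 0 \<longleftrightarrow> x = y"
    by (simp add: fun_eq_iff)
  assume z: "z \<in> car (ell (ennreal p))"
  show "ndist (ell (ennreal p)) x z \<le> ndist (ell (ennreal p)) x y + ndist (ell (ennreal p)) y z"
    using minkowski_powr(2)[OF p, of "\<lambda>n. x n - y n" "\<lambda>n. y n - z n"] diff x y z p
    by (simp add: ndist_def ell_def)
qed

end

theory Submission
  imports Defs
begin

text \<open>
  The witness is the diagonal series \<open>f(x) = (x\<^sub>j ^ d\<^sub>j / d\<^sub>j!)\<^sub>j\<close> with exponents \<open>d\<^sub>j \<ge> 1\<close> that tend to
  infinity very slowly.  If \<open>K\<close> is relatively \<open>p\<close>-compact in \<open>\<ell>\<^sub>p\<close>, Hoelder's inequality bounds the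
  \<open>j\<close>-th coordinates on \<open>K\<close> by \<open>(\<Sum>\<^sub>n |y\<^sub>n(j)|^p)^(1/p)\<close>, so the \<open>p\<close>-th powers of the coordinatewise
  suprema over \<open>K\<close> are summable.  On an \<open>e\<close>-ball around any point the \<open>j\<close>-th coordinate of \<open>f\<close> reaches
  \<open>(e/2)^d\<^sub>j / d\<^sub>j!\<close>, and the \<open>p\<close>-th powers of these numbers have a divergent sum because every exponent
  is repeated so often.  The Taylor polynomials at \<open>y\<close> are diagonal, \<open>x \<mapsto> (a\<^sub>j x\<^sub>j ^ k)\<^sub>j\<close>, and
  \<open>|a\<^sub>j| \<le> exp \<parallel>y\<parallel> |y\<^sub>j|\<close> as soon as \<open>d\<^sub>j > k\<close>; hence \<open>a\<close> is absolutely summable, and the unit ball is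
  mapped into \<open>{x. |x\<^sub>j| \<le> |a\<^sub>j|}\<close>, which is relatively \<open>r\<close>-compact for every \<open>r \<ge> 1\<close>.
\<close>

section \<open>Sequence spaces\<close>

lemma car_ell: "0 \<le> p \<Longrightarrow> x \<in> car (ell (ennreal p)) \<longleftrightarrow> summable (\<lambda>n. norm (x n) powr p)"
  by (simp add: ell_def)

lemma nrm_ell: "0 \<le> p \<Longrightarrow> nrm (ell (ennreal p)) x = (\<Sum>n. norm (x n) powr p) powr (1 / p)"
  by (simp add: ell_def)

lemma scl_ell: "scl (ell q) = (\<lambda>c x n. c * x n)"
  by (simp add: ell_def)

lemma car_ell_1: "x \<in> car (ell 1) \<longleftrightarrow> summable (\<lambda>n. norm (x n))"
  by (simp add: ell_def)

lemma nrm_ell_1: "x \<in> car (ell 1) \<Longrightarrow> nrm (ell 1) x = (\<Sum>n. norm (x n))"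
  by (simp add: ell_def suminf_nonneg)

lemma nrm_ell_nonneg: "0 \<le> p \<Longrightarrow> 0 \<le> nrm (ell (ennreal p)) x"
  by (simp add: nrm_ell)

lemma Metric_space_ell_1: "Metric_space (car (ell 1)) (ndist (ell 1))"
  using Metric_space_ell[of 1] by simp

lemma ell_add: 
  assumes "1 \<le> p" "x \<in> car (ell (ennreal p))" "y \<in> car (ell (ennreal p))"
  shows "x + y \<in> car (ell (ennreal p))"
  using minkowski_powr(1)[of p x y] assms by (simp add: car_ell)

lemma ell_diff: 
  assumes "1 \<le> p" "x \<in> car (ell (ennreal p))" "y \<in> car (ell (ennreal p))"
  shows "x - y \<in> car (ell (ennreal p))"
  using minkowski_powr(1)[of p x "\<lambda>n. - y n"] assms by (simp add: car_ell)

lemma ell_zero: "1 \<le> p \<Longrightarrow> 0 \<in> car (ell (ennreal p))"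
  by (simp add: car_ell)

lemma ell_sum:
  assumes "1 \<le> p" "\<And>i. i \<in> I \<Longrightarrow> x i \<in> car (ell (ennreal p))"
  shows "(\<Sum>i\<in>I. x i) \<in> car (ell (ennreal p))"
  using assms(2) by (induction I rule: infinite_finite_induct) (auto simp: ell_zero ell_add assms(1))

lemma sum_fun_app: "(\<Sum>i\<in>I. f i) j = (\<Sum>i\<in>I. f i j)" for f :: "'i \<Rightarrow> 'a \<Rightarrow> 'b::comm_monoid_add"
  by (induction I rule: infinite_finite_induct) auto

lemma norm_coord_le_nrm:
  assumes "1 \<le> p" "x \<in> car (ell (ennreal p))"
  shows "norm (x j) \<le> nrm (ell (ennreal p)) x"
proof -
  have "norm (x j) powr p \<le> (\<Sum>n. norm (x n) powr p)"
    using assms sum_le_suminf[of "\<lambda>n. norm (x n) powr p" "{j}"] by (simp add: car_ell)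
  then have "(norm (x j) powr p) powr (1 / p) \<le> (\<Sum>n. norm (x n) powr p) powr (1 / p)"
    using assms by (intro powr_mono2) auto
  then show ?thesis
    using assms by (simp add: nrm_ell powr_powr)
qed

lemma norm_coord_le_nrm_1: "x \<in> car (ell 1) \<Longrightarrow> norm (x j) \<le> nrm (ell 1) x"
  using norm_coord_le_nrm[of 1 x j] by simp

text \<open>With \<open>S\<close> the \<Sum>-norm, every entry is at most \<open>S\<close>, so
  |x_n|^p <= S^(p-1) |x_n|, and summing gives S^p. This lets all later estimates be made in the
  simpler 1-norm.\<close>

lemma ell_1_subset_ell:
  assumes p: "1 \<le> p" and x: "summable (\<lambda>n. norm (x n))"
  shows "x \<in> car (ell (ennreal p))"
    and "nrm (ell (ennreal p)) x \<le> (\<Sum>n. norm (x n))"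
proof -
  define S where "S = (\<Sum>n. norm (x n))"
  have S: "0 \<le> S" "norm (x n) \<le> S" for n
    using sum_le_suminf[OF x, of "{n}"] suminf_nonneg[OF x] by (simp_all add: S_def)
  have le: "norm (x n) powr p \<le> S powr (p - 1) * norm (x n)" for n
  proof (cases "x n = 0")
    case False
    then have "norm (x n) powr p = norm (x n) powr (p - 1) * norm (x n)"
      using powr_add[of "norm (x n)" "p - 1" 1] by simp
    also have "\<dots> \<le> S powr (p - 1) * norm (x n)"
      using S p by (intro mult_right_mono powr_mono2) auto
    finally show ?thesis .
  qed simp
  have sm: "summable (\<lambda>n. norm (x n) powr p)"
    by (rule summable_comparison_test'[OF summable_mult[OF x], of 0]) (use le in simp)
  then show "x \<in> car (ell (ennreal p))"
    using p by (simp add: car_ell)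
  have "(\<Sum>n. norm (x n) powr p) \<le> (\<Sum>n. S powr (p - 1) * norm (x n))"
    by (intro suminf_le le sm summable_mult x)
  also have "\<dots> = S powr (p - 1) * S"
    using suminf_mult[OF x] by (simp add: S_def)
  also have "\<dots> = S powr p"
    using powr_add[of S "p - 1" 1] S by (cases "S = 0") auto
  finally have "(\<Sum>n. norm (x n) powr p) powr (1 / p) \<le> (S powr p) powr (1 / p)"
    using p by (intro powr_mono2 suminf_nonneg sm) auto
  then show "nrm (ell (ennreal p)) x \<le> (\<Sum>n. norm (x n))"
    using p S by (simp add: nrm_ell powr_powr S_def)
qed

text \<open>Replaces open sets by balls, with the difference oriented as \<open>x - y\<close> to
  match the argument of the Taylor polynomials.\<close>

lemma neighborhood_ell_1_iff:
  "neighborhood (ell 1) y V \<longleftrightarrow> V \<subseteq> car (ell 1) \<and> y \<in> car (ell 1) \<and>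
    (\<exists>e>0. \<forall>x\<in>car (ell 1). nrm (ell 1) (x - y) < e \<longrightarrow> x \<in> V)"
proof -
  interpret Metric_space "car (ell 1)" "ndist (ell 1)"
    by (rule Metric_space_ell_1)
  have comm: "ndist (ell 1) y x = nrm (ell 1) (x - y)" for x
    using commute[of y x] by (simp add: ndist_def)
  have "(\<exists>U. openin mtopology U \<and> y \<in> U \<and> U \<subseteq> V) \<longleftrightarrow>
      y \<in> car (ell 1) \<and> (\<exists>e>0. mball y e \<subseteq> V)"
    (is "?L = ?R")
  proof
    assume ?L
    then obtain U where U: "openin mtopology U" "y \<in> U" "U \<subseteq> V" by blast
    then obtain e where "0 < e" "mball y e \<subseteq> U" unfolding openin_mtopology by blast
    moreover have "y \<in> car (ell 1)" using U openin_mtopology by blast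
    ultimately show ?R using U(3) by blast
  next
    assume ?R
    then obtain e where "y \<in> car (ell 1)" "0 < e" "mball y e \<subseteq> V" by blast
    then show ?L by (intro exI[of _ "mball y e"]) simp
  qed
  then show ?thesis
    unfolding neighborhood_def ntop_def
    by (auto simp: subset_iff comm)
qed

section \<open>Relatively \<open>p\<close>-compact sets in \<open>\<ell>\<^sub>p\<close>\<close>

text \<open>Translates the extended-real equation into real arithmetic: \<open>q = 0\<close> would
  make \<open>1 / q\<close> infinite, \<open>q = top\<close> forces \<open>p = 1\<close>, and any
  other \<open>q\<close> is a real exponent above 1.\<close>

lemma conjugate_exponent_cases:
  assumes p: "1 \<le> p" and q: "1 / ennreal p + 1 / q = 1"
  shows "p = 1 \<and> q = \<infinity> \<or> (\<exists>s. q = ennreal s \<and> 1 / p + 1 / s = 1 \<and> 1 < p \<and> 1 < s)"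
proof -
  have "1 / ennreal p = ennreal (1 / p)"
    using p divide_ennreal[of 1 p] by simp
  with q have e: "ennreal (1 / p) + 1 / q = 1" by simp
  show ?thesis
  proof (cases q)
    case (real s)
    show ?thesis
    proof (cases "s = 0")
      case True
      then show ?thesis using e real by simp
    next
      case False
      with real have s0: "0 < s" by simp
      then have "1 / q = ennreal (1 / s)"
        using real divide_ennreal[of 1 s] by simp
      with e have "ennreal (1 / p + 1 / s) = ennreal 1"
        using p s0 by (simp add: ennreal_plus)
      then have eq: "1 / p + 1 / s = 1"
        using p s0 by (subst (asm) ennreal_inj) auto
      moreover have "0 < 1 / p" "0 < 1 / s" using p s0 by auto
      ultimately have "1 / s < 1" "1 / p < 1" by linarith+
      then have "1 < s" "1 < p" using s0 p by (simp_all add: divide_less_eq)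
      then show ?thesis using eq real by blast
    qed
  next
    case top
    then have "ennreal (1 / p) = ennreal 1" using e by simp
    then have "1 / p = 1" using p by (subst (asm) ennreal_inj) auto
    then show ?thesis using p top by simp
  qed
qed

text \<open>For \<open>p = 1\<close> every |\<alpha>_n| is at most 1; otherwise Young's inequality
  is summed after dividing \<open>v\<close> by its norm. Partial sums suffice, since
  \<open>p_co\<close> consists of limits of partial sums.\<close>

lemma hoelder_sum:
  fixes v :: "nat \<Rightarrow> complex"
  assumes p: "1 \<le> p" and q: "1 / ennreal p + 1 / q = 1" and \<alpha>: "\<alpha> \<in> nball (ell q)"
    and v: "summable (\<lambda>n. norm (v n) powr p)"
  shows "norm (\<Sum>n<N. \<alpha> n * v n) \<le> (\<Sum>n. norm (v n) powr p) powr (1 / p)"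
proof -
  define S where "S = (\<Sum>n. norm (v n) powr p) powr (1 / p)"
  have conj: "p = 1 \<and> q = \<infinity> \<or> (\<exists>s. q = ennreal s \<and> 1 / p + 1 / s = 1 \<and> 1 < p \<and> 1 < s)"
    using conjugate_exponent_cases[OF p q] by blast
  have S0: "0 \<le> S" by (simp add: S_def)
  have Sp: "S powr p = (\<Sum>n. norm (v n) powr p)"
    using p v by (simp add: S_def powr_powr suminf_nonneg)
  have fin: "(\<Sum>n<N. norm (v n) powr p) \<le> S powr p"
    unfolding Sp by (intro sum_le_suminf v) auto
  have "norm (\<Sum>n<N. \<alpha> n * v n) \<le> (\<Sum>n<N. norm (\<alpha> n) * norm (v n))"
    using norm_sum[of "\<lambda>n. \<alpha> n * v n" "{..<N}"] by (simp add: norm_mult)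
  also have "\<dots> \<le> S"
  \<comment> \<open>The normalization divides by \<open>S\<close>; if \<open>S\<close> vanishes, so
    do all \<open>v n\<close>.\<close>
  proof (cases "S = 0")
    case True
    then have "\<forall>n. norm (v n) powr p = 0"
      using suminf_eq_zero_iff[OF v] Sp p by simp
    then show ?thesis using True by simp
  next
    case False
    with S0 have S: "0 < S" by simp
    show ?thesis
    proof (cases "p = 1")
      case True
      have "q = \<infinity>"
        using conj True by auto
      then have bd: "bounded (range \<alpha>)" and le: "(SUP n. norm (\<alpha> n)) \<le> 1"
        using \<alpha> by (auto simp: nball_def ell_def)
      have "norm (\<alpha> n) \<le> 1" for n
      proof -
        have "bdd_above (range (\<lambda>n. norm (\<alpha> n)))"
          using bd by (auto simp: bounded_iff bdd_above_def)
        then show ?thesis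
          using cSUP_upper[of n UNIV "\<lambda>n. norm (\<alpha> n)"] le by simp
      qed
      then have "(\<Sum>n<N. norm (\<alpha> n) * norm (v n)) \<le> (\<Sum>n<N. norm (v n))"
        by (intro sum_mono mult_left_le_one_le) auto
      then show ?thesis using fin True S by simp
    next
      case False
      with p have p1: "1 < p" by simp
      with conj obtain s where s: "q = ennreal s" "1 / p + 1 / s = 1" "1 < s"
        by auto
      have sm: "summable (\<lambda>n. norm (\<alpha> n) powr s)"
        and le: "(\<Sum>n. norm (\<alpha> n) powr s) powr (1 / s) \<le> 1"
        using \<alpha> s by (auto simp: nball_def car_ell nrm_ell)
      have "(\<Sum>n. norm (\<alpha> n) powr s) = ((\<Sum>n. norm (\<alpha> n) powr s) powr (1 / s)) powr s"
        using s by (simp add: powr_powr suminf_nonneg sm)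
      also have "\<dots> \<le> 1 powr s"
        using s le by (intro powr_mono2) auto
      finally have le1: "(\<Sum>n. norm (\<alpha> n) powr s) \<le> 1" by simp
      have "(\<Sum>n<N. norm (\<alpha> n) powr s) \<le> 1"
        using sum_le_suminf[OF sm, of "{..<N}"] le1 by simp
      moreover have "(\<Sum>n<N. (norm (v n) / S) powr p) \<le> 1"
        using fin S by (simp add: powr_divide flip: sum_divide_distrib)
      moreover have "(\<Sum>n<N. norm (\<alpha> n) * (norm (v n) / S)) \<le>
          (\<Sum>n<N. norm (\<alpha> n) powr s / s + (norm (v n) / S) powr p / p)"
        using p1 s S by (intro sum_mono Youngs_inequality) auto
      ultimately have "(\<Sum>n<N. norm (\<alpha> n) * (norm (v n) / S)) \<le> 1 / s + 1 / p"
        using p1 s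
          divide_right_mono[of "\<Sum>n<N. norm (\<alpha> n) powr s" 1 s]
          divide_right_mono[of "\<Sum>n<N. (norm (v n) / S) powr p" 1 p]
        by (simp add: sum.distrib flip: sum_divide_distrib)
      then have "(\<Sum>n<N. norm (\<alpha> n) * norm (v n)) / S \<le> 1"
        using s by (simp add: sum_divide_distrib)
      then show ?thesis using S by (simp add: divide_le_eq)
    qed
  qed
  finally show ?thesis by (simp add: S_def)
qed

lemma coord_limit:
  assumes p: "1 \<le> p" and lim: "limitin (ntop (ell (ennreal p))) X s sequentially"
  shows "(\<lambda>n. X n j) \<longlonglongrightarrow> s j"
proof -
  interpret Metric_space "car (ell (ennreal p))" "ndist (ell (ennreal p))"
    by (rule Metric_space_ell[OF p])
  have s: "s \<in> car (ell (ennreal p))"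
    and ev: "\<And>e. 0 < e \<Longrightarrow> \<forall>\<^sub>F n in sequentially. X n \<in> car (ell (ennreal p)) \<and>
      ndist (ell (ennreal p)) (X n) s < e"
    using lim unfolding ntop_def limitin_metric by auto
  show ?thesis
    unfolding tendsto_iff
  proof (intro allI impI)
    fix e :: real assume "0 < e"
    from ev[OF this] show "\<forall>\<^sub>F n in sequentially. dist (X n j) (s j) < e"
    proof eventually_elim
      case (elim n)
      then show ?case
        using norm_coord_le_nrm[OF p ell_diff[OF p _ s], of "X n" j]
        by (simp add: ndist_def dist_norm)
    qed
  qed
qed

text \<open>This necessary condition is the obstruction used against the witness. Interchanging sums
  bounds the total of the \<open>s j\<close> by that of the p-th powers of the norms of the
  \<open>y n\<close>; Hoelder gives the bound on \<open>p_co\<close>, and continuity of coordinates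
  carries it to the closure.\<close>

lemma rel_p_compact_imp_coord_bound:
  assumes p: "1 \<le> p" and K: "rel_p_compact p (ell (ennreal p)) K"
  obtains s where "summable s" "\<And>x j. x \<in> K \<Longrightarrow> norm (x j) powr p \<le> s j"
proof -
  interpret Metric_space "car (ell (ennreal p))" "ndist (ell (ennreal p))"
    by (rule Metric_space_ell[OF p])
  obtain y where y: "\<And>n. y n \<in> car (ell (ennreal p))"
    "summable (\<lambda>n. nrm (ell (ennreal p)) (y n) powr p)"
    and sub: "K \<subseteq> ntop (ell (ennreal p)) closure_of p_co p (ell (ennreal p)) y"
    using K by (auto simp: rel_p_compact_def ell_seq_def)
  define s where "s j = (\<Sum>n. norm (y n j) powr p)" for j
  have nrm: "nrm (ell (ennreal p)) (y n) powr p = (\<Sum>j. norm (y n j) powr p)"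
      and smy: "summable (\<lambda>j. norm (y n j) powr p)" for n
    using p y(1)[of n] by (simp_all add: nrm_ell powr_powr car_ell suminf_nonneg)
  have sm: "summable (\<lambda>n. norm (y n j) powr p)" for j
    by (rule summable_comparison_test'[OF y(2), of 0])
       (use p norm_coord_le_nrm[OF p y(1), of _ j] in \<open>auto intro!: powr_mono2\<close>)
  have "summable s"
  proof (rule bounded_imp_summable)
    show "0 \<le> s j" for j
      by (simp add: s_def suminf_nonneg sm)
    show "(\<Sum>j\<le>J. s j) \<le> (\<Sum>n. nrm (ell (ennreal p)) (y n) powr p)" for J
    proof -
      \<comment> \<open>Only finitely many \<open>j\<close> are summed at a time, so the interchange
        is plain additivity of convergent series.\<close>
      have "(\<Sum>j\<le>J. s j) = (\<Sum>n. \<Sum>j\<le>J. norm (y n j) powr p)"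
        unfolding s_def by (rule suminf_sum[symmetric]) (rule sm)
      also have "\<dots> \<le> (\<Sum>n. nrm (ell (ennreal p)) (y n) powr p)"
        unfolding nrm
        by (intro suminf_le sum_le_suminf smy summable_sum sm)
           (use y(2) in \<open>auto simp: nrm\<close>)
      finally show ?thesis .
    qed
  qed
  moreover have "norm (x j) powr p \<le> s j" if "x \<in> K" for x j
  proof -
    have co: "norm (z j) \<le> s j powr (1 / p)" if "z \<in> p_co p (ell (ennreal p)) y" for z
    proof -
      from that obtain q \<alpha> where q: "1 / ennreal p + 1 / q = 1" "\<alpha> \<in> nball (ell q)"
        and lim: "limitin (ntop (ell (ennreal p)))
          (\<lambda>N. \<Sum>n<N. scl (ell (ennreal p)) (\<alpha> n) (y n)) z sequentially"
        by (auto simp: p_co_def)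
      have "(\<lambda>N. \<Sum>n<N. \<alpha> n * y n j) \<longlonglongrightarrow> z j"
        using coord_limit[OF p lim, of j] by (simp add: sum_fun_app scl_ell)
      then have "(\<lambda>N. norm (\<Sum>n<N. \<alpha> n * y n j)) \<longlonglongrightarrow> norm (z j)"
        by (rule tendsto_norm)
      then show ?thesis
        using hoelder_sum[OF p q sm[of j]] by (intro LIMSEQ_le_const2) (auto simp: s_def)
    qed
    have x: "x \<in> car (ell (ennreal p))"
      and cl: "\<And>e. 0 < e \<Longrightarrow> \<exists>z\<in>p_co p (ell (ennreal p)) y. z \<in> mball x e"
      using that sub unfolding ntop_def metric_closure_of by auto
    have "norm (x j) \<le> s j powr (1 / p)"
    proof (rule field_le_epsilon)
      fix e :: real assume "0 < e"
      from cl[OF this] obtain z where z: "z \<in> p_co p (ell (ennreal p)) y" "z \<in> mball x e" by blast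
      then have "norm (x j - z j) < e"
        using norm_coord_le_nrm[OF p ell_diff[OF p x, of z], of j] by (simp add: ndist_def)
      then show "norm (x j) \<le> s j powr (1 / p) + e"
        using co[OF z(1)] norm_triangle_sub[of "x j" "z j"] by linarith
    qed
    then have "norm (x j) powr p \<le> (s j powr (1 / p)) powr p"
      using p by (intro powr_mono2) auto
    also have "\<dots> = s j"
      using p by (simp add: powr_powr s_def suminf_nonneg sm)
    finally show ?thesis .
  qed
  ultimately show ?thesis using that by blast
qed


section \<open>Sets dominated coordinatewise by a summable sequence\<close>

lemma sum_coords:
  "(\<Sum>n<N. scl (ell q) (\<alpha> n) (\<lambda>i. if i = n then b n else 0)) = (\<lambda>i. if i < N then \<alpha> i * b i else 0)"
  by (rule ext) (simp add: sum_fun_app scl_ell if_distrib cong: if_cong)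

lemma nrm_unit_coord:
  assumes "1 \<le> p"
  shows "(\<lambda>i. if i = n then b else 0) \<in> car (ell (ennreal p))"
    and "nrm (ell (ennreal p)) (\<lambda>i. if i = n then b else 0) = norm b"
proof -
  have "(\<lambda>i. norm (if i = n then b else 0) powr p) = (\<lambda>i. if i = n then norm b powr p else 0)"
    by auto
  moreover have "(\<lambda>i. if i = n then norm b powr p else 0) sums (norm b powr p)"
    using sums_single[of n "\<lambda>_. norm b powr p"] by simp
  ultimately have "(\<lambda>i. norm (if i = n then b else 0) powr p) sums (norm b powr p)"
    by simp
  then show "(\<lambda>i. if i = n then b else 0) \<in> car (ell (ennreal p))"
    and "nrm (ell (ennreal p)) (\<lambda>i. if i = n then b else 0) = norm b"
    using assms by (auto simp: car_ell nrm_ell sums_iff powr_powr)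
qed

text \<open>The distance from the truncation to \<open>x\<close> is at most a tail of the absolutely
  convergent series of the entries.\<close>

lemma truncation_limit:
  assumes p: "1 \<le> p" and x: "summable (\<lambda>n. norm (x n))"
  shows "limitin (ntop (ell (ennreal p))) (\<lambda>N i. if i < N then x i else 0) x sequentially"
proof -
  interpret Metric_space "car (ell (ennreal p))" "ndist (ell (ennreal p))"
    by (rule Metric_space_ell[OF p])
  have sm: "summable (\<lambda>i. norm (if i < N then x i else 0))" for N
    by (rule summable_comparison_test'[OF x, of 0]) simp
  have le: "ndist (ell (ennreal p)) (\<lambda>i. if i < N then x i else 0) x \<le> (\<Sum>i. norm (x (i + N)))" for N
  proof -
    let ?z = "(\<lambda>i. if i < N then x i else 0) - x"
    have z: "norm (?z i) = (if i < N then 0 else norm (x i))" for i by auto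
    have smz: "summable (\<lambda>i. norm (?z i))"
      by (rule summable_comparison_test'[OF x, of 0]) simp
    have "nrm (ell (ennreal p)) ?z \<le> (\<Sum>i. norm (?z i))"
      by (rule ell_1_subset_ell(2)[OF p smz])
    also have "\<dots> = (\<Sum>i. norm (?z (i + N))) + (\<Sum>i<N. norm (?z i))"
      by (rule suminf_split_initial_segment[OF smz])
    also have "\<dots> = (\<Sum>i. norm (x (i + N)))"
      unfolding z by simp
    finally show ?thesis by (simp add: ndist_def)
  qed
  have "(\<lambda>N. ndist (ell (ennreal p)) (\<lambda>i. if i < N then x i else 0) x) \<longlonglongrightarrow> 0"
    by (rule tendsto_sandwich[OF _ _ tendsto_const suminf_exist_split2[OF x]]) (use le in auto)
  then show ?thesis
    unfolding ntop_def limitin_metric_dist_null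
    using ell_1_subset_ell(1)[OF p x] ell_1_subset_ell(1)[OF p sm] by simp
qed

text \<open>Scaled unit vectors \<open>y n\<close> suffice: each \<open>x\<close> in
  \<open>K\<close> is the limit of the combinations with coefficients x_n / b_n, so \<open>K\<close>
  lies in \<open>p_co\<close> even before the closure is taken.\<close>

lemma rel_p_compact_if_dominated:
  fixes a :: "nat \<Rightarrow> real"
  assumes p: "1 \<le> p" and r: "1 \<le> r" and a: "summable a" "\<And>j. 0 \<le> a j"
    and K: "\<And>x j. x \<in> K \<Longrightarrow> norm (x j) \<le> a j"
  shows "rel_p_compact r (ell (ennreal p)) K"
proof -
  interpret Metric_space "car (ell (ennreal p))" "ndist (ell (ennreal p))"
    by (rule Metric_space_ell[OF p])
  \<comment> \<open>Dividing by \<open>C\<close> brings the coefficients into the dual unit ball.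
    Being at least 1, \<open>C\<close> is a legal divisor even for \<open>a = 0\<close> and
    satisfies C <= C^q.\<close>
  define C where "C = max 1 (suminf a)"
  have C: "1 \<le> C" "suminf a \<le> C" by (auto simp: C_def)
  \<comment> \<open>Splitting \<open>a = a^(1/r) \<cdot> a^(1 - 1/r)\<close> puts the first factor in \<open>\<ell>\<^sub>r\<close> and the second in the dual space.\<close>
  define b where "b n = C * a n powr (1 / r)" for n
  define y where "y n = (\<lambda>i. if i = n then complex_of_real (b n) else 0)" for n :: nat
  have b0: "0 \<le> b n" for n using C by (simp add: b_def)
  have nrm_y: "nrm (ell (ennreal p)) (y n) = b n" for n
    using nrm_unit_coord(2)[OF p, of n "complex_of_real (b n)"] b0[of n] by (simp add: y_def)
  have "nrm (ell (ennreal p)) (y n) powr r = C powr r * a n" for n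
    unfolding nrm_y using C r a(2) by (simp add: b_def powr_mult powr_powr)
  then have y: "y \<in> ell_seq r (ell (ennreal p))"
    using nrm_unit_coord(1)[OF p] a(1) by (simp add: ell_seq_def y_def summable_mult)
  have "x \<in> p_co r (ell (ennreal p)) y" if x: "x \<in> K" for x
  proof -
    have smx: "summable (\<lambda>n. norm (x n))"
      by (rule summable_comparison_test'[OF a(1), of 0]) (use K[OF x] in simp)
    \<comment> \<open>Where \<open>b n = 0\<close>, also \<open>a n = 0\<close> and hence
      \<open>x n = 0\<close>; division by zero then returns the correct coefficient 0.\<close>
    define \<alpha> where "\<alpha> n = x n / complex_of_real (b n)" for n
    have \<alpha>b: "\<alpha> n * complex_of_real (b n) = x n" for n
    proof (cases "a n = 0")
      case True
      then show ?thesis using K[OF x, of n] by (simp add: \<alpha>_def)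
    next
      case False
      then show ?thesis using C by (simp add: \<alpha>_def b_def)
    qed
    have \<alpha>le: "norm (\<alpha> n) \<le> a n powr (1 - 1 / r) / C" for n
    proof (cases "a n = 0")
      case True
      then show ?thesis using K[OF x, of n] by (simp add: \<alpha>_def)
    next
      case False
      have "norm (\<alpha> n) = norm (x n) / b n"
        using b0[of n] by (simp add: \<alpha>_def norm_divide)
      also have "\<dots> \<le> a n / b n"
        using b0 K[OF x] by (intro divide_right_mono) auto
      also have "\<dots> = a n powr (1 - 1 / r) / C"
        using False a(2)[of n] by (simp add: b_def powr_diff)
      finally show ?thesis .
    qed
    have "\<exists>q. 1 / ennreal r + 1 / q = 1 \<and> \<alpha> \<in> nball (ell q)"
    proof (cases "r = 1")
      case True
      have "norm (\<alpha> n) \<le> 1" for n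
      proof -
        have "norm (\<alpha> n) \<le> a n powr 0 / C" using \<alpha>le[of n] True by simp
        \<comment> \<open>By convention \<open>0 powr 0\<close> is 0, so the numerator is 0 or
          1.\<close>
        also have "\<dots> \<le> 1" using C by (simp add: powr_def)
        finally show ?thesis .
      qed
      then have "\<alpha> \<in> nball (ell \<infinity>)"
        by (auto simp: nball_def ell_def bounded_iff intro!: cSUP_least)
      then show ?thesis using True by (intro exI[of _ \<infinity>]) simp
    next
      case False
      with r have r1: "1 < r" by simp
      define q where "q = r / (r - 1)"
      have q: "1 < q" "1 / r + 1 / q = 1" "(1 - 1 / r) * q = 1"
        using r1 by (auto simp: q_def field_simps)
      have "1 / ennreal r + 1 / ennreal q = ennreal (1 / r) + ennreal (1 / q)"
        using r1 q divide_ennreal[of 1 r] divide_ennreal[of 1 q] by simp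
      also have "\<dots> = 1"
        using r1 q(1,2) ennreal_plus[of "1 / r" "1 / q"] by simp
      finally have conj: "1 / ennreal r + 1 / ennreal q = 1" .
      have le: "norm (\<alpha> n) powr q \<le> a n / C" for n
      proof -
        have "norm (\<alpha> n) powr q \<le> (a n powr (1 - 1 / r) / C) powr q"
          using q \<alpha>le by (intro powr_mono2) auto
        also have "\<dots> = a n / C powr q"
          using C a(2)[of n] q by (simp add: powr_divide powr_powr)
        also have "\<dots> \<le> a n / C"
          using C a(2)[of n] q powr_mono[of 1 q C] by (intro divide_left_mono) auto
        finally show ?thesis .
      qed
      have sm: "summable (\<lambda>n. norm (\<alpha> n) powr q)"
        by (rule summable_comparison_test'[OF summable_divide[OF a(1)], of 0]) (use le in simp)
      have "(\<Sum>n. norm (\<alpha> n) powr q) \<le> (\<Sum>n. a n / C)"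
        by (intro suminf_le le sm summable_divide a(1))
      also have "\<dots> \<le> 1"
        using C by (simp add: suminf_divide[OF a(1)])
      finally have "(\<Sum>n. norm (\<alpha> n) powr q) powr (1 / q) \<le> 1 powr (1 / q)"
        using q by (intro powr_mono2 suminf_nonneg sm) auto
      then have "\<alpha> \<in> nball (ell (ennreal q))"
        using q sm by (simp add: nball_def car_ell nrm_ell)
      then show ?thesis using conj by blast
    qed
    moreover have "limitin (ntop (ell (ennreal p)))
        (\<lambda>N. \<Sum>n<N. scl (ell (ennreal p)) (\<alpha> n) (y n)) x sequentially"
      unfolding y_def sum_coords \<alpha>b by (rule truncation_limit[OF p smx])
    ultimately show ?thesis by (auto simp: p_co_def)
  qed
  moreover have "p_co r (ell (ennreal p)) y \<subseteq> ntop (ell (ennreal p)) closure_of p_co r (ell (ennreal p)) y"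
    by (rule closure_of_subset) (auto simp: p_co_def ntop_def dest: limitin_topspace)
  ultimately show ?thesis
    unfolding rel_p_compact_def using y by blast
qed

section \<open>Uniqueness of Taylor expansions\<close>

text \<open>The constant term is the limit at 0; once it vanishes, dividing by \<open>z\<close>
  shifts the coefficients. Assuming convergence only for nonzero \<open>z\<close> makes the
  hypothesis stable under this division.\<close>

lemma powser_zero_imp_coeff_zero:
  fixes a :: "nat \<Rightarrow> complex"
  assumes "0 < s" "\<And>z. z \<noteq> 0 \<Longrightarrow> norm z < s \<Longrightarrow> (\<lambda>n. a n * z ^ n) sums 0"
  shows "a m = 0"
proof -
  have head: "b 0 = 0" if b: "\<And>z. z \<noteq> 0 \<Longrightarrow> norm z < s \<Longrightarrow> (\<lambda>n. b n * z ^ n) sums 0" for b :: "nat \<Rightarrow> complex"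
  proof -
    have "((\<lambda>_. 0) \<longlongrightarrow> b 0) (at (0::complex))"
      by (rule powser_limit_0_strong[where a = b and f = "\<lambda>_. 0" and s = s]) (use assms(1) b in auto)
    then show ?thesis
      by (metis tendsto_const tendsto_unique trivial_limit_at)
  qed
  show ?thesis
    using assms(2)
  proof (induction m arbitrary: a)
    case (0 a)
    then show ?case by (rule head)
  next
    case (Suc m a)
    have "(\<lambda>n. a (Suc n) * z ^ n) sums 0" if z: "z \<noteq> 0" "norm z < s" for z
    proof -
      have "(\<lambda>n. a (Suc n) * z ^ Suc n) sums 0"
        using Suc.prems[OF z] head[OF Suc.prems] sums_Suc_iff[of "\<lambda>n. a n * z ^ n" 0] by simp
      then have "(\<lambda>n. a (Suc n) * z ^ Suc n * inverse z) sums (0 * inverse z)"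
        by (rule sums_mult2)
      moreover have "a (Suc n) * z ^ Suc n * inverse z = a (Suc n) * z ^ n" for n
        using z by simp
      ultimately show ?thesis
        by (simp only: mult_zero_left)
    qed
    from Suc.IH[OF this] show ?case by simp
  qed
qed

text \<open>The slots of the multilinear map are changed from \<open>x\<close> to \<open>z x\<close>
  one at a time, each change releasing one factor \<open>z\<close>; the induction counts the changed
  slots.\<close>

lemma cont_hom_poly_scl:
  assumes P: "cont_hom_poly E F m P" and x: "x \<in> car E" and zx: "\<And>c. scl E c x \<in> car E"
    and F: "F = ell q"
  shows "P (scl E z x) j = z ^ m * P x j"
proof -
  obtain A where A: "multilinear E F m A" and PA: "\<And>x. x \<in> car E \<Longrightarrow> P x = A (\<lambda>i\<in>{..<m}. x)"
    using P by (auto simp: cont_hom_poly_def)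
  have "A (\<lambda>i\<in>{..<m}. if i < k then scl E z x else x) j = z ^ k * A (\<lambda>i\<in>{..<m}. x) j" if "k \<le> m" for k
    using that
  proof (induction k)
    case (Suc k)
    define v where "v = (\<lambda>i\<in>{..<m}. if i < k then scl E z x else x)"
    have v: "v \<in> {..<m} \<rightarrow>\<^sub>E car E" using x zx by (auto simp: v_def)
    have "A (v(k := scl E z x)) = scl F z (A (v(k := x)))"
      using A v Suc.prems x unfolding multilinear_def by auto
    moreover have IH: "A v j = z ^ k * A (\<lambda>i\<in>{..<m}. x) j"
      unfolding v_def by (rule Suc.IH) (use Suc.prems in simp)
    moreover have "v(k := scl E z x) = (\<lambda>i\<in>{..<m}. if i < Suc k then scl E z x else x)"
      "v(k := x) = v"
      using Suc.prems by (auto simp: v_def fun_eq_iff restrict_def)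
    ultimately show ?case
      by (metis (no_types, lifting) F IH mult.assoc power_Suc scl_ell)
  qed simp
  from this[of m] have "A (\<lambda>i\<in>{..<m}. scl E z x) j = z ^ m * A (\<lambda>i\<in>{..<m}. x) j"
    by (simp cong: restrict_cong)
  then show ?thesis using PA x zx by simp
qed


text \<open>Restricting the expansion to the complex line through \<open>y\<close> in direction
  \<open>x\<close> and reading off one coordinate leaves a scalar power series in \<open>z\<close>.
  One radius serves all coordinates.\<close>

lemma taylor_coord_sums:
  assumes p: "1 \<le> p" and f: "f \<in> car (ell 1) \<rightarrow> car (ell (ennreal p))"
    and T: "taylor_expansion (ell 1) (ell (ennreal p)) f y P"
    and x: "x \<in> car (ell 1)"
  obtains s where "0 < s"
    "\<forall>z j. norm z < s \<longrightarrow> (\<lambda>m. P m x j * z ^ m) sums f (y + (\<lambda>n. z * x n)) j"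
proof -
  have P: "cont_hom_poly (ell 1) (ell (ennreal p)) m (P m)" for m
    using T by (simp add: taylor_expansion_def)
  obtain V where V: "neighborhood (ell 1) y V"
    and lim: "\<And>e. 0 < e \<Longrightarrow> \<exists>N. \<forall>n\<ge>N. \<forall>x\<in>V. nrm (ell (ennreal p)) (f x - (\<Sum>m<n. P m (x - y))) < e"
    using T by (auto simp: taylor_expansion_def)
  obtain e where y: "y \<in> car (ell 1)" and e: "0 < e"
    "\<And>x. x \<in> car (ell 1) \<Longrightarrow> nrm (ell 1) (x - y) < e \<Longrightarrow> x \<in> V"
    using V by (auto simp: neighborhood_ell_1_iff)
  \<comment> \<open>This keeps \<open>z x\<close> inside the ball of radius \<open>e\<close>; the
    added 1 covers \<open>x = 0\<close>.\<close>
  define s where "s = e / (nrm (ell 1) x + 1)"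
  have x0: "0 \<le> nrm (ell 1) x" using nrm_ell_nonneg[of 1 x] by simp
  have zx: "(\<lambda>n. c * x n) \<in> car (ell 1)" for c
    using x by (simp add: car_ell_1 norm_mult summable_mult)
  have Pcar: "P m v \<in> car (ell (ennreal p))" if "v \<in> car (ell 1)" for m v
    using P[of m] that by (fastforce simp: cont_hom_poly_def multilinear_def)
  have "(\<lambda>m. P m x j * z ^ m) sums f (y + (\<lambda>n. z * x n)) j" if z: "norm z < s" for z j
  proof -
    define w where "w = y + (\<lambda>n. z * x n)"
    have wy: "w - y = (\<lambda>n. z * x n)" by (simp add: w_def)
    have w: "w \<in> car (ell 1)"
      using ell_add[of 1 y "\<lambda>n. z * x n"] y zx by (simp add: w_def)
    have "nrm (ell 1) (w - y) = norm z * nrm (ell 1) x"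
      unfolding wy using x zx by (simp add: nrm_ell_1 norm_mult suminf_mult car_ell_1)
    also have "\<dots> \<le> norm z * (nrm (ell 1) x + 1)"
      by (simp add: mult_left_mono)
    also have "\<dots> < e"
      using z x0 by (simp add: s_def pos_less_divide_eq)
    finally have wV: "w \<in> V" using e w by blast
    have eq: "(\<Sum>m<n. P m x j * z ^ m) = (\<Sum>m<n. P m (w - y)) j" for n
      unfolding sum_fun_app wy
      using cont_hom_poly_scl[OF P x, where z = z and j = j] zx by (simp add: scl_ell mult.commute)
    have "(\<lambda>n. \<Sum>m<n. P m x j * z ^ m) \<longlonglongrightarrow> f w j"
      unfolding lim_sequentially
    proof (intro allI impI)
      fix r :: real assume "0 < r"
      from lim[OF this] obtain N where
        N: "\<And>n. n \<ge> N \<Longrightarrow> nrm (ell (ennreal p)) (f w - (\<Sum>m<n. P m (w - y))) < r"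
        using wV by blast
      have "dist (\<Sum>m<n. P m x j * z ^ m) (f w j) < r" if "n \<ge> N" for n
      proof -
        have "norm ((f w - (\<Sum>m<n. P m (w - y))) j) \<le> nrm (ell (ennreal p)) (f w - (\<Sum>m<n. P m (w - y)))"
          using f w zx by (intro norm_coord_le_nrm p ell_diff ell_sum Pcar) (auto simp: wy)
        then show ?thesis
          unfolding eq using N[OF that] by (simp add: dist_norm norm_minus_commute)
      qed
      then show "\<exists>N. \<forall>n\<ge>N. dist (\<Sum>m<n. P m x j * z ^ m) (f w j) < r" by blast
    qed
    then show ?thesis
      by (simp add: sums_def w_def)
  qed
  moreover have "0 < s" using e x0 by (simp add: s_def)
  ultimately show ?thesis using that by blast
qed

lemma taylor_expansion_unique:
  assumes p: "1 \<le> p" and f: "f \<in> car (ell 1) \<rightarrow> car (ell (ennreal p))"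
    and P: "taylor_expansion (ell 1) (ell (ennreal p)) f y P"
    and Q: "taylor_expansion (ell 1) (ell (ennreal p)) f y Q"
    and x: "x \<in> car (ell 1)"
  shows "P m x = Q m x"
proof
  fix j
  obtain s where s: "0 < s"
    "\<forall>z j. norm z < s \<longrightarrow> (\<lambda>m. P m x j * z ^ m) sums f (y + (\<lambda>n. z * x n)) j"
    using taylor_coord_sums[OF p f P x] by blast
  obtain t where t: "0 < t"
    "\<forall>z j. norm z < t \<longrightarrow> (\<lambda>m. Q m x j * z ^ m) sums f (y + (\<lambda>n. z * x n)) j"
    using taylor_coord_sums[OF p f Q x] by blast
  have "P m x j - Q m x j = 0"
  proof (rule powser_zero_imp_coeff_zero[of "min s t" "\<lambda>m. P m x j - Q m x j"])
    fix z :: complex assume "norm z < min s t"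
    then show "(\<lambda>n. (P n x j - Q n x j) * z ^ n) sums 0"
      using sums_diff[of "\<lambda>m. P m x j * z ^ m" _ "\<lambda>m. Q m x j * z ^ m"] s(2) t(2) by (fastforce simp: left_diff_distrib)
  qed (use s t in simp)
  then show "P m x j = Q m x j" by simp
qed

text \<open>Uniqueness transfers an explicit expansion to the polynomials picked by
  \<open>SOME\<close>. Agreement on the carrier is enough, because compactness only concerns the
  image of the unit ball.\<close>

lemma taylor_poly_eq:
  assumes "1 \<le> p" "f \<in> car (ell 1) \<rightarrow> car (ell (ennreal p))"
    and P: "taylor_expansion (ell 1) (ell (ennreal p)) f y P"
  shows "cont_hom_poly (ell 1) (ell (ennreal p)) m (taylor_poly (ell 1) (ell (ennreal p)) m f y)"
    and "x \<in> car (ell 1) \<Longrightarrow> taylor_poly (ell 1) (ell (ennreal p)) m f y x = P m x"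
proof -
  have Q: "taylor_expansion (ell 1) (ell (ennreal p)) f y
      (SOME P. taylor_expansion (ell 1) (ell (ennreal p)) f y P)"
    using P by (rule someI[of "taylor_expansion (ell 1) (ell (ennreal p)) f y"])
  then show "cont_hom_poly (ell 1) (ell (ennreal p)) m (taylor_poly (ell 1) (ell (ennreal p)) m f y)"
    by (simp add: taylor_expansion_def taylor_poly_def)
  show "taylor_poly (ell 1) (ell (ennreal p)) m f y x = P m x" if "x \<in> car (ell 1)"
    unfolding taylor_poly_def by (rule taylor_expansion_unique[OF assms(1,2) Q P that])
qed

section \<open>Diagonal power series\<close>

lemma power_div_fact_le_exp:
  assumes "0 \<le> (R::real)" shows "R ^ n / fact n \<le> exp R"
proof -
  have "R ^ n / fact n = (\<Sum>i\<in>{n}. inverse (fact i) * R ^ i)"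
    by (simp add: field_simps)
  also have "\<dots> \<le> (\<Sum>i. inverse (fact i) * R ^ i)"
    using assms by (intro sum_le_suminf summable_exp) auto
  also have "\<dots> = exp R"
    by (simp add: exp_def divide_inverse mult.commute)
  finally show ?thesis .
qed

text \<open>Splitting off one factor \<open>u\<close> keeps a quantity that is summable over the
  coordinates, while the factor 1/n provides the decay of Taylor remainders.\<close>

lemma power_div_fact_le:
  fixes u R :: real
  assumes "0 \<le> u" "u \<le> R" "0 < n"
  shows "u ^ n / fact n \<le> u * exp R / n"
proof -
  obtain k where k: "n = Suc k" using assms(3) by (cases n) auto
  have "u ^ n / fact n = u * (u ^ k / fact k) / n"
    by (simp add: k field_simps)
  also have "\<dots> \<le> u * exp R / n"
  proof (intro divide_right_mono mult_left_mono)
    have "u ^ k / fact k \<le> R ^ k / fact k"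
      using assms by (intro divide_right_mono power_mono) auto
    also have "\<dots> \<le> exp R"
      using assms by (intro power_div_fact_le_exp) auto
    finally show "u ^ k / fact k \<le> exp R" .
  qed (use assms in auto)
  finally show ?thesis .
qed

definition diag_series :: "(nat \<Rightarrow> nat) \<Rightarrow> (nat \<Rightarrow> complex) \<Rightarrow> nat \<Rightarrow> complex" where
  "diag_series d x = (\<lambda>j. x j ^ d j / fact (d j))"

text \<open>These are the binomial coefficients of (y_j + h_j)^D / D! in powers of h_j, where
  \<open>D = d j\<close>, with D! cancelled.\<close>

definition diag_coeff :: "(nat \<Rightarrow> nat) \<Rightarrow> (nat \<Rightarrow> complex) \<Rightarrow> nat \<Rightarrow> nat \<Rightarrow> complex" where
  "diag_coeff d y k j = (if k \<le> d j then y j ^ (d j - k) / (fact k * fact (d j - k)) else 0)"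

definition diag_poly :: "nat \<Rightarrow> (nat \<Rightarrow> complex) \<Rightarrow> (nat \<Rightarrow> complex) \<Rightarrow> nat \<Rightarrow> complex" where
  "diag_poly k a x = (\<lambda>j. a j * x j ^ k)"

text \<open>As soon as \<open>d j\<close> exceeds \<open>k\<close>, a factor y_j survives in the
  coefficient and dominates it up to a constant. Since \<open>d\<close> tends to infinity, only
  finitely many indices escape.\<close>

lemma summable_diag_coeff:
  assumes y: "y \<in> car (ell 1)" and d: "filterlim d at_top sequentially"
  shows "summable (\<lambda>j. norm (diag_coeff d y k j))"
proof -
  define R where "R = nrm (ell 1) y"
  have R: "norm (y j) \<le> R" for j
    unfolding R_def by (rule norm_coord_le_nrm_1[OF y])
  have "norm (diag_coeff d y k j) \<le> norm (y j) * exp R" if "k < d j" for j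
  proof -
    have "norm (diag_coeff d y k j) = norm (y j) ^ (d j - k) / fact (d j - k) / fact k"
      using that by (simp add: diag_coeff_def norm_divide norm_power norm_mult)
    also have "\<dots> \<le> norm (y j) ^ (d j - k) / fact (d j - k) / 1"
      by (intro divide_left_mono) (auto simp: fact_ge_1)
    also have "\<dots> \<le> norm (y j) * exp R / (d j - k)"
      using R that power_div_fact_le[of "norm (y j)" R "d j - k"] by simp
    also have "\<dots> \<le> norm (y j) * exp R / 1"
      using that by (intro divide_left_mono) auto
    finally show ?thesis by simp
  qed
  moreover have "\<forall>\<^sub>F j in sequentially. k < d j"
    using d unfolding filterlim_at_top by (simp add: less_eq_Suc_le)
  ultimately have "\<forall>\<^sub>F j in sequentially. norm (norm (diag_coeff d y k j)) \<le> norm (y j) * exp R"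
    by (auto elim: eventually_mono)
  then show ?thesis
    by (rule summable_comparison_test_ev) (use y in \<open>simp add: car_ell_1 summable_mult2\<close>)
qed

section \<open>Diagonal homogeneous polynomials\<close>

lemma summable_dominated:
  fixes a t :: "nat \<Rightarrow> complex"
  assumes "summable (\<lambda>j. norm (a j))" "\<And>j. norm (t j) \<le> C"
  shows "summable (\<lambda>j. norm (a j * t j))"
  by (rule summable_comparison_test'[OF summable_mult2[OF assms(1), of C], of 0])
     (simp add: norm_mult mult_left_mono assms(2))

text \<open>Local Lipschitz bound from factoring u^k - v^k. At \<open>k = 0\<close> the truncated
  exponent \<open>k - 1\<close> is harmless because of the factor \<open>k\<close>.\<close>

lemma norm_diff_power_le:
  fixes u v :: complex
  assumes "norm u \<le> R" "norm v \<le> R"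
  shows "norm (u ^ k - v ^ k) \<le> k * R ^ (k - 1) * norm (u - v)"
proof -
  have R: "0 \<le> R" using assms(1) norm_ge_zero[of u] by linarith
  have "norm (u ^ k - v ^ k) = norm (\<Sum>i<k. v ^ (k - Suc i) * u ^ i) * norm (u - v)"
    by (simp add: power_diff_sumr2 norm_mult mult.commute)
  also have "\<dots> \<le> (\<Sum>i<k. R ^ (k - 1)) * norm (u - v)"
  proof (intro mult_right_mono sum_norm_le)
    fix i assume "i \<in> {..<k}"
    then have "norm (v ^ (k - Suc i) * u ^ i) \<le> R ^ (k - Suc i) * R ^ i"
      unfolding norm_mult norm_power using assms R by (intro mult_mono power_mono) auto
    also have "\<dots> = R ^ (k - 1)"
      using \<open>i \<in> {..<k}\<close> by (simp flip: power_add)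
    finally show "norm (v ^ (k - Suc i) * u ^ i) \<le> R ^ (k - 1)" .
  qed simp
  finally show ?thesis by simp
qed


lemma nrm_ell_mult_le:
  assumes p: "1 \<le> p" and a: "summable (\<lambda>j. norm (a j))" and t: "\<And>j. norm (t j) \<le> C"
  shows "(\<lambda>j. a j * t j) \<in> car (ell (ennreal p))"
    and "nrm (ell (ennreal p)) (\<lambda>j. a j * t j) \<le> (\<Sum>j. norm (a j)) * C"
proof -
  note sm = summable_dominated[OF a t]
  show "(\<lambda>j. a j * t j) \<in> car (ell (ennreal p))"
    by (rule ell_1_subset_ell(1)[OF p sm])
  have "nrm (ell (ennreal p)) (\<lambda>j. a j * t j) \<le> (\<Sum>j. norm (a j * t j))"
    by (rule ell_1_subset_ell(2)[OF p sm])
  also have "\<dots> \<le> (\<Sum>j. norm (a j) * C)"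
    by (intro suminf_le sm summable_mult2 a) (simp add: norm_mult mult_left_mono t)
  also have "\<dots> = (\<Sum>j. norm (a j)) * C"
    by (rule suminf_mult2[OF a, symmetric])
  finally show "nrm (ell (ennreal p)) (\<lambda>j. a j * t j) \<le> (\<Sum>j. norm (a j)) * C" .
qed

lemma multilinear_diag:
  assumes p: "1 \<le> p" and a: "summable (\<lambda>j. norm (a j))"
  shows "multilinear (ell 1) (ell (ennreal p)) k (\<lambda>v j. a j * (\<Prod>i<k. v i j))"
  unfolding multilinear_def
proof (intro conjI ballI allI impI)
  show "(\<lambda>v j. a j * (\<Prod>i<k. v i j)) \<in> ({..<k} \<rightarrow>\<^sub>E car (ell 1)) \<rightarrow> car (ell (ennreal p))"
  proof
    fix v assume v: "v \<in> {..<k} \<rightarrow>\<^sub>E car (ell 1)"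
    have "norm (\<Prod>i<k. v i j) \<le> (\<Prod>i<k. nrm (ell 1) (v i))" for j
      unfolding prod_norm[symmetric] using v by (intro prod_mono) (auto intro: norm_coord_le_nrm_1)
    then show "(\<lambda>j. a j * (\<Prod>i<k. v i j)) \<in> car (ell (ennreal p))"
      by (rule nrm_ell_mult_le(1)[OF p a])
  qed
  fix v and i u w c assume i: "i < k"
  have upd: "(\<Prod>l<k. (v(i := t)) l j) = t j * (\<Prod>l\<in>{..<k} - {i}. v l j)" for t :: "nat \<Rightarrow> complex" and j
  proof -
    have "(\<Prod>l<k. (v(i := t)) l j) = (v(i := t)) i j * (\<Prod>l\<in>{..<k} - {i}. (v(i := t)) l j)"
      using i by (intro prod.remove) auto
    also have "(\<Prod>l\<in>{..<k} - {i}. (v(i := t)) l j) = (\<Prod>l\<in>{..<k} - {i}. v l j)"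
      by (intro prod.cong) auto
    finally show ?thesis by simp
  qed
  show "(\<lambda>j. a j * (\<Prod>l<k. (v(i := u + w)) l j)) =
      (\<lambda>j. a j * (\<Prod>l<k. (v(i := u)) l j)) + (\<lambda>j. a j * (\<Prod>l<k. (v(i := w)) l j))"
    unfolding upd by (simp add: fun_eq_iff algebra_simps)
  show "(\<lambda>j. a j * (\<Prod>l<k. (v(i := scl (ell 1) c u)) l j)) =
      scl (ell (ennreal p)) c (\<lambda>j. a j * (\<Prod>l<k. (v(i := u)) l j))"
    unfolding upd by (simp add: fun_eq_iff scl_ell)
qed

lemma continuous_diag_poly:
  assumes p: "1 \<le> p" and a: "summable (\<lambda>j. norm (a j))"
  shows "continuous_map (ntop (ell 1)) (ntop (ell (ennreal p))) (diag_poly k a)"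
proof -
  interpret Metric_space "car (ell 1)" "ndist (ell 1)"
    by (rule Metric_space_ell_1)
  show ?thesis
    unfolding ntop_def metric_continuous_map[OF Metric_space_ell[OF p]]
  proof (intro conjI ballI allI impI)
    show "diag_poly k a ` car (ell 1) \<subseteq> car (ell (ennreal p))"
    proof clarify
      fix x assume x: "x \<in> car (ell 1)"
      have "norm (x j ^ k) \<le> nrm (ell 1) x ^ k" for j
        unfolding norm_power using norm_coord_le_nrm_1[OF x] by (intro power_mono) auto
      then show "diag_poly k a x \<in> car (ell (ennreal p))"
        unfolding diag_poly_def by (rule nrm_ell_mult_le(1)[OF p a])
    qed
    fix x and e :: real assume x: "x \<in> car (ell 1)" and e: "0 < e"
    \<comment> \<open>\<open>R\<close> bounds the coordinates of all points within distance 1 of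
      \<open>x\<close>, and \<open>M\<close> is a Lipschitz constant there; hence the radius
      \<open>min 1 (e / (M + 1))\<close>.\<close>
    define R where "R = nrm (ell 1) x + 1"
    define M where "M = (\<Sum>j. norm (a j)) * (k * R ^ (k - 1))"
    have R: "0 \<le> R" using nrm_ell_nonneg[of 1 x] by (simp add: R_def)
    have M: "0 \<le> M" using R by (simp add: M_def suminf_nonneg[OF a])
    have "ndist (ell (ennreal p)) (diag_poly k a x) (diag_poly k a z) < e"
      if z: "z \<in> car (ell 1)" and d: "ndist (ell 1) x z < min 1 (e / (M + 1))" for z
    proof -
      have xz: "x - z \<in> car (ell 1)" using ell_diff[of 1 x z] x z by simp
      have xj: "norm (x j) \<le> R" for j
        using norm_coord_le_nrm_1[OF x, of j] by (simp add: R_def)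
      have xzj: "norm (x j - z j) \<le> ndist (ell 1) x z" for j
        using norm_coord_le_nrm_1[OF xz, of j] by (simp add: ndist_def)
      have zj: "norm (z j) \<le> R" for j
        using norm_triangle_ineq2[of "z j" "x j"] norm_coord_le_nrm_1[OF x, of j] xzj[of j] d
        by (simp add: R_def norm_minus_commute)
      have "norm (x j ^ k - z j ^ k) \<le> k * R ^ (k - 1) * ndist (ell 1) x z" for j
      proof -
        have "norm (x j ^ k - z j ^ k) \<le> k * R ^ (k - 1) * norm (x j - z j)"
          by (rule norm_diff_power_le[OF xj zj])
        also have "\<dots> \<le> k * R ^ (k - 1) * ndist (ell 1) x z"
          using xzj R by (intro mult_left_mono) auto
        finally show ?thesis .
      qed
      from nrm_ell_mult_le(2)[OF p a this]
      have "ndist (ell (ennreal p)) (diag_poly k a x) (diag_poly k a z) \<le> M * ndist (ell 1) x z"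
        by (simp add: ndist_def diag_poly_def M_def fun_diff_def right_diff_distrib mult.assoc)
      also have "\<dots> \<le> (M + 1) * ndist (ell 1) x z"
        by (simp add: mult_right_mono)
      also have "\<dots> < e"
        using d M by (simp add: pos_less_divide_eq mult.commute)
      finally show ?thesis .
    qed
    then show "\<exists>\<delta>>0. \<forall>z. z \<in> car (ell 1) \<and> ndist (ell 1) x z < \<delta> \<longrightarrow>
        ndist (ell (ennreal p)) (diag_poly k a x) (diag_poly k a z) < e"
      using e M by (intro exI[of _ "min 1 (e / (M + 1))"]) auto
  qed
qed

lemma cont_hom_poly_diag_poly:
  assumes "1 \<le> p" "summable (\<lambda>j. norm (a j))"
  shows "cont_hom_poly (ell 1) (ell (ennreal p)) k (diag_poly k a)"
  unfolding cont_hom_poly_def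
  using multilinear_diag[OF assms] continuous_diag_poly[OF assms]
  by (intro conjI exI[of _ "\<lambda>v j. a j * (\<Prod>i<k. v i j)"]) (auto simp: diag_poly_def)

text \<open>The binomial expansion stops at \<open>D = d j\<close>, so nothing remains when
  \<open>D < n\<close>. Otherwise the tail is at most the whole sum of norms, (|y_j| + |h_j|)^D /
  D!, and \<open>n \<le> D\<close> turns the factor 1/D into 1/n, uniformly in
  \<open>j\<close>.\<close>

lemma diag_remainder_coord:
  fixes y h :: "nat \<Rightarrow> complex"
  assumes n: "0 < n" and u: "norm (y j) + norm (h j) \<le> R"
  shows "norm (diag_series d (y + h) j - (\<Sum>k<n. diag_coeff d y k j * h j ^ k))
    \<le> (norm (y j) + norm (h j)) * exp R / n"
proof -
  define D where "D = d j"
  define c where "c = (\<lambda>v k. v ^ (D - k) / (fact k * fact (D - k)))"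
  \<comment> \<open>Stated over any field of characteristic zero, for use over the complex numbers
    to expand and over the reals to resum the norms.\<close>
  have binom: "(v + w) ^ D / fact D = (\<Sum>k\<le>D. v ^ (D - k) / (fact k * fact (D - k)) * w ^ k)"
    for v w :: "'x::field_char_0"
    unfolding add.commute[of v] binomial_ring sum_divide_distrib
    by (intro sum.cong) (auto simp: binomial_fact)
  have "(\<Sum>k<n. diag_coeff d y k j * h j ^ k) =
      (\<Sum>k\<in>{..D} \<inter> {..<n}. y j ^ (D - k) / (fact k * fact (D - k)) * h j ^ k)"
    by (rule sum.mono_neutral_cong_right) (auto simp: diag_coeff_def D_def)
  moreover have "diag_series d (y + h) j =
      (\<Sum>k\<le>D. y j ^ (D - k) / (fact k * fact (D - k)) * h j ^ k)"
    using binom[of "y j" "h j"] by (simp add: diag_series_def D_def)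
  ultimately have eq: "diag_series d (y + h) j - (\<Sum>k<n. diag_coeff d y k j * h j ^ k) =
      (\<Sum>k\<in>{..D} - {..<n}. y j ^ (D - k) / (fact k * fact (D - k)) * h j ^ k)"
    by (simp add: sum.Int_Diff[of "{..D}" _ "{..<n}"])
  show ?thesis
  proof (cases "D < n")
    case True
    then have empty: "{..D} - {..<n} = {}" by auto
    show ?thesis unfolding eq empty by simp
  next
    case False
    have "norm (diag_series d (y + h) j - (\<Sum>k<n. diag_coeff d y k j * h j ^ k)) \<le>
        (\<Sum>k\<in>{..D} - {..<n}. norm (y j) ^ (D - k) / (fact k * fact (D - k)) * norm (h j) ^ k)"
      unfolding eq by (rule sum_norm_le) (simp add: norm_mult norm_divide norm_power)
    also have "\<dots> \<le> (\<Sum>k\<le>D. norm (y j) ^ (D - k) / (fact k * fact (D - k)) * norm (h j) ^ k)"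
      by (rule sum_mono2) auto
    also have "\<dots> = (norm (y j) + norm (h j)) ^ D / fact D"
      by (rule binom[symmetric])
    also have "\<dots> \<le> (norm (y j) + norm (h j)) * exp R / D"
      using u n False by (intro power_div_fact_le) auto
    also have "\<dots> \<le> (norm (y j) + norm (h j)) * exp R / n"
      using n False by (intro divide_left_mono) auto
    finally show ?thesis .
  qed
qed

text \<open>The coordinate bounds are summed in the 1-norm, where the weights |y_j| + |h_j| add up
  to the two norms.\<close>

lemma diag_remainder:
  assumes p: "1 \<le> p" and y: "y \<in> car (ell 1)" and h: "h \<in> car (ell 1)" and n: "0 < n"
    and R: "nrm (ell 1) y + nrm (ell 1) h \<le> R"
  shows "nrm (ell (ennreal p)) (diag_series d (y + h) - (\<Sum>k<n. diag_poly k (diag_coeff d y k) h))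
    \<le> R * exp R / n"
proof -
  let ?z = "diag_series d (y + h) - (\<Sum>k<n. diag_poly k (diag_coeff d y k) h)"
  have le: "norm (?z j) \<le> (norm (y j) + norm (h j)) * (exp R / n)" for j
    using diag_remainder_coord[OF n, of y j h R d] R
      norm_coord_le_nrm_1[OF y, of j] norm_coord_le_nrm_1[OF h, of j]
    by (simp add: sum_fun_app diag_poly_def)
  have yh: "summable (\<lambda>j. norm (y j) + norm (h j))"
    using y h by (intro summable_add) (simp_all add: car_ell_1)
  have sm: "summable (\<lambda>j. norm (?z j))"
    by (rule summable_comparison_test'[OF summable_mult2[OF yh, of "exp R / n"], of 0]) (use le in simp)
  have "nrm (ell (ennreal p)) ?z \<le> (\<Sum>j. norm (?z j))"
    by (rule ell_1_subset_ell(2)[OF p sm])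
  also have "\<dots> \<le> (\<Sum>j. (norm (y j) + norm (h j)) * (exp R / n))"
    by (intro suminf_le le sm summable_mult2 yh)
  also have "\<dots> = (nrm (ell 1) y + nrm (ell 1) h) * (exp R / n)"
    using y h suminf_mult2[OF yh, of "exp R / n"] suminf_add[of "\<lambda>j. norm (y j)" "\<lambda>j. norm (h j)"]
    by (simp only: nrm_ell_1 car_ell_1)
  also have "\<dots> \<le> R * (exp R / n)"
    using R by (intro mult_right_mono) auto
  finally show ?thesis by simp
qed

lemma diag_series_in_ell:
  assumes p: "1 \<le> p" and d: "\<And>j. 0 < d j" and x: "x \<in> car (ell 1)"
  shows "diag_series d x \<in> car (ell (ennreal p))"
proof (rule ell_1_subset_ell(1)[OF p])
  have le: "norm (diag_series d x j) \<le> norm (x j) * exp (nrm (ell 1) x)" for j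
  proof -
    have "norm (diag_series d x j) = norm (x j) ^ d j / fact (d j)"
      by (simp add: diag_series_def norm_divide norm_power)
    also have "\<dots> \<le> norm (x j) * exp (nrm (ell 1) x) / d j"
      using d norm_coord_le_nrm_1[OF x] by (intro power_div_fact_le) auto
    also have "\<dots> \<le> norm (x j) * exp (nrm (ell 1) x) / 1"
      using d[of j] by (intro divide_left_mono) auto
    finally show ?thesis by simp
  qed
  show "summable (\<lambda>j. norm (diag_series d x j))"
    by (rule summable_comparison_test'[OF summable_mult2, of "\<lambda>j. norm (x j)" 0])
       (use le x in \<open>simp_all add: car_ell_1\<close>)
qed

text \<open>On the unit ball around \<open>y\<close> the remainder is at most R exp(R) / n with
  \<open>R\<close> depending on \<open>y\<close> alone, which gives uniform convergence.\<close>

lemma taylor_expansion_diag_series: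
  assumes p: "1 \<le> p" and d: "filterlim d at_top sequentially" and y: "y \<in> car (ell 1)"
  shows "taylor_expansion (ell 1) (ell (ennreal p)) (diag_series d) y
    (\<lambda>k. diag_poly k (diag_coeff d y k))"
  unfolding taylor_expansion_def
proof (intro conjI allI)
  show "cont_hom_poly (ell 1) (ell (ennreal p)) k (diag_poly k (diag_coeff d y k))" for k
    by (rule cont_hom_poly_diag_poly[OF p summable_diag_coeff[OF y d]])
  define V where "V = {x \<in> car (ell 1). nrm (ell 1) (x - y) < 1}"
  define R where "R = nrm (ell 1) y + 1"
  have R: "0 \<le> R" using nrm_ell_nonneg[of 1 y] by (simp add: R_def)
  have "\<exists>N. \<forall>n\<ge>N. \<forall>x\<in>V. nrm (ell (ennreal p))
      (diag_series d x - (\<Sum>k<n. diag_poly k (diag_coeff d y k) (x - y))) < e" if e: "0 < e" for e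
  proof -
    obtain N where N: "R * exp R / e < real N" using reals_Archimedean2 by blast
    have "nrm (ell (ennreal p))
        (diag_series d x - (\<Sum>k<n. diag_poly k (diag_coeff d y k) (x - y))) < e"
      if "x \<in> V" "N \<le> n" for x n
    proof -
      have nN: "R * exp R / e < real n" using N that by linarith
      have "0 \<le> R * exp R / e" using R e by simp
      with nN have n: "0 < n" by linarith
      have "nrm (ell (ennreal p))
          (diag_series d (y + (x - y)) - (\<Sum>k<n. diag_poly k (diag_coeff d y k) (x - y))) \<le> R * exp R / n"
        using that ell_diff[of 1 x y] y by (intro diag_remainder p n) (auto simp: V_def R_def)
      also have "\<dots> < e"
        using nN e n by (simp add: field_simps)
      finally show ?thesis by simp
    qed
    then show ?thesis by blast
  qed
  moreover have "neighborhood (ell 1) y V"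
    using y by (auto simp: neighborhood_ell_1_iff V_def intro!: exI[of _ 1])
  ultimately show "\<exists>V. neighborhood (ell 1) y V \<and> (\<forall>e>0. \<exists>N. \<forall>n\<ge>N. \<forall>x\<in>V. nrm (ell (ennreal p))
      (diag_series d x - (\<Sum>k<n. diag_poly k (diag_coeff d y k) (x - y))) < e)"
    by blast
qed

section \<open>Compact Taylor polynomials of a function that is nowhere
  \<open>p\<close>-compact\<close>

lemma p_compact_taylor_poly_diag_series:
  assumes p: "1 \<le> p" and r: "1 \<le> r" and d: "filterlim d at_top sequentially" "\<And>j. 0 < d j"
    and y: "y \<in> car (ell 1)"
  shows "p_compact_poly r (ell 1) (ell (ennreal p)) (taylor_poly (ell 1) (ell (ennreal p)) k (diag_series d) y)"
proof -
  have f: "diag_series d \<in> car (ell 1) \<rightarrow> car (ell (ennreal p))"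
    using diag_series_in_ell[OF p, of d] d(2) by blast
  note T = taylor_poly_eq[OF p f taylor_expansion_diag_series[OF p d(1) y]]
  have "rel_p_compact r (ell (ennreal p))
      (taylor_poly (ell 1) (ell (ennreal p)) k (diag_series d) y ` nball (ell 1))"
  proof (rule rel_p_compact_if_dominated[OF p r summable_diag_coeff[OF y d(1)]])
    fix z j assume "z \<in> taylor_poly (ell 1) (ell (ennreal p)) k (diag_series d) y ` nball (ell 1)"
    then obtain x where x: "x \<in> car (ell 1)" "nrm (ell 1) x \<le> 1"
      and z: "z = diag_poly k (diag_coeff d y k) x"
      using T(2) by (auto simp: nball_def)
    have "norm (x j) \<le> 1" using norm_coord_le_nrm_1[OF x(1), of j] x(2) by linarith
    then have "norm (diag_coeff d y k j) * norm (x j) ^ k \<le> norm (diag_coeff d y k j) * 1"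
      by (intro mult_left_mono power_le_one) auto
    then show "norm (z j) \<le> norm (diag_coeff d y k j)"
      by (simp add: z diag_poly_def norm_mult norm_power)
  qed simp
  then show ?thesis using T(1) by (auto simp: p_compact_poly_def)
qed

text \<open>The number \<open>s j\<close> bounds the j-th coordinate over the whole image of
  \<open>V\<close>, so a different test point may be used for each \<open>j\<close>:
  \<open>y\<close> moved in its j-th coordinate only.\<close>

lemma not_p_compact_at_diag_series:
  assumes p: "1 \<le> p"
    and div: "\<And>\<delta>. 0 < \<delta> \<Longrightarrow> \<not> summable (\<lambda>j. (\<delta> ^ d j / fact (d j)) powr p)"
  shows "\<not> p_compact_at p (ell 1) (ell (ennreal p)) (diag_series d) y"
proof
  assume "p_compact_at p (ell 1) (ell (ennreal p)) (diag_series d) y"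
  then obtain V where V: "neighborhood (ell 1) y V"
    and K: "rel_p_compact p (ell (ennreal p)) (diag_series d ` V)"
    by (auto simp: p_compact_at_def)
  obtain s where s: "summable s"
    "\<And>x j. x \<in> diag_series d ` V \<Longrightarrow> norm (x j) powr p \<le> s j"
    using rel_p_compact_imp_coord_bound[OF p K] by blast
  obtain e where y: "y \<in> car (ell 1)" and e: "0 < e"
    "\<And>x. x \<in> car (ell 1) \<Longrightarrow> nrm (ell 1) (x - y) < e \<Longrightarrow> x \<in> V"
    using V by (auto simp: neighborhood_ell_1_iff)
  define \<delta> where "\<delta> = e / 2"
  have \<delta>: "0 < \<delta>" "\<delta> < e" using e by (auto simp: \<delta>_def)
  have le: "(\<delta> ^ d j / fact (d j)) powr p \<le> s j" for j
  proof -
    \<comment> \<open>One of \<delta> and -\<delta> works: y_j + \<delta> and y_j - \<delta> differ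
      by 2\<delta>, so they cannot both have norm below \<delta>.\<close>
    have "\<exists>t. norm t = \<delta> \<and> \<delta> \<le> norm (y j + t)"
    proof (rule ccontr)
      assume *: "\<not> ?thesis"
      then have "norm (y j + of_real \<delta>) < \<delta>" "norm (y j + - of_real \<delta>) < \<delta>"
        using \<delta> by (metis abs_of_pos norm_of_real not_le, metis abs_of_pos norm_minus_cancel norm_of_real not_le)
      moreover have "norm (2 * of_real \<delta> :: complex) \<le> norm (y j + of_real \<delta>) + norm (y j + - of_real \<delta>)"
        using norm_triangle_ineq4[of "y j + of_real \<delta>" "y j + - of_real \<delta>"] by simp
      ultimately show False using \<delta> by (simp add: norm_mult)
    qed
    then obtain t where t: "norm t = \<delta>" "\<delta> \<le> norm (y j + t)" by blast
    define x where "x = y + (\<lambda>i. if i = j then t else 0)"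
    have "x \<in> car (ell 1)"
      using ell_add[of 1 y] nrm_unit_coord(1)[of 1 j t] y by (simp add: x_def)
    moreover have "nrm (ell 1) (x - y) < e"
      using nrm_unit_coord(2)[of 1 j t] t \<delta> by (simp add: x_def)
    ultimately have "norm (diag_series d x j) powr p \<le> s j"
      using e s(2) by blast
    moreover have "\<delta> ^ d j / fact (d j) \<le> norm (diag_series d x j)"
      using t \<delta> by (simp add: diag_series_def x_def norm_divide norm_power divide_right_mono power_mono)
    ultimately show ?thesis
      using p \<delta> powr_mono2[of p "\<delta> ^ d j / fact (d j)" "norm (diag_series d x j)"] by simp
  qed
  have "summable (\<lambda>j. (\<delta> ^ d j / fact (d j)) powr p)"
    by (rule summable_comparison_test'[OF s(1), of 0]) (use le in simp)
  with div \<delta>(1) show False by blast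
qed

text \<open>Comparison with the harmonic series. Since m! <= m^m, the logarithm of the term with m =
  d_j is at least -p m (ln m - ln \<delta>), which eventually exceeds -m^2 ln 2 >= -ln(j + 2). One
  \<open>d\<close> thus serves all \<open>p\<close> and \<delta>.\<close>

lemma slow_degrees:
  obtains d :: "nat \<Rightarrow> nat" where "\<forall>j. 0 < d j" "filterlim d at_top sequentially"
    "\<forall>p \<delta>. 0 < p \<longrightarrow> 0 < \<delta> \<longrightarrow> \<not> summable (\<lambda>j. (\<delta> ^ d j / fact (d j) :: real) powr p)"
proof -
  \<comment> \<open>\<open>d j = m\<close> for roughly \<open>2^((m+1)^2) - 2^(m^2)\<close> indices \<open>j\<close>, which outgrows \<open>(m!)^p / \<delta>^(p m)\<close>.\<close>
  define d :: "nat \<Rightarrow> nat" where "d j = nat \<lfloor>sqrt (log 2 (real j + 2))\<rfloor>" for j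
  have ge: "m \<le> d j" if "2 ^ (m\<^sup>2) \<le> real j + 2" for m j
  proof -
    have "real (m\<^sup>2) \<le> log 2 (real j + 2)"
      using that by (simp add: le_log_iff powr_realpow flip: of_nat_power)
    then have "real m \<le> sqrt (log 2 (real j + 2))"
      by (intro real_le_rsqrt) simp
    then show ?thesis by (simp add: d_def le_nat_iff le_floor_iff)
  qed
  \<comment> \<open>The shift by 2 in \<open>d\<close> makes the logarithm at least 1 already at
    \<open>j = 0\<close>.\<close>
  have pos: "0 < d j" for j
    using ge[of 1 j] by simp
  have lim: "filterlim d at_top sequentially"
    unfolding filterlim_at_top
  proof
    fix m
    have "m \<le> d j" if "2 ^ (m\<^sup>2) \<le> j" for j
    proof (rule ge)
      have "real (2 ^ (m\<^sup>2)) \<le> real j" using that by (simp only: of_nat_le_iff)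
      then have "2 ^ (m\<^sup>2) \<le> real j" by (simp only: of_nat_power of_nat_numeral)
      then show "2 ^ (m\<^sup>2) \<le> real j + 2" by linarith
    qed
    then show "\<forall>\<^sub>F j in sequentially. m \<le> d j"
      unfolding eventually_sequentially by blast
  qed
  have sq: "(real (d j))\<^sup>2 * ln 2 \<le> ln (real j + 2)" for j
  proof -
    have l0: "0 \<le> log 2 (real j + 2)" by simp
    have "real (d j) \<le> sqrt (log 2 (real j + 2))"
      using l0 by (simp add: d_def)
    then have "(real (d j))\<^sup>2 \<le> (sqrt (log 2 (real j + 2)))\<^sup>2"
      by (intro power_mono) auto
    then show ?thesis using l0 by (simp add: log_def field_simps)
  qed
  have "\<not> summable (\<lambda>j. (\<delta> ^ d j / fact (d j)) powr p)" if p: "0 < p" and \<delta>: "0 < \<delta>" for p \<delta> :: real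
  proof
    assume sm: "summable (\<lambda>j. (\<delta> ^ d j / fact (d j)) powr p)"
    \<comment> \<open>The quotient (ln m - ln \<delta>) / m tends to 0, hence p m (ln m - ln
      \<delta>) eventually stays below m^2 ln 2.\<close>
    have "((\<lambda>x::real. ln x / x - ln \<delta> / x) \<longlongrightarrow> 0 - 0) at_top"
      by (intro tendsto_diff ln_x_over_x_tendsto_0 real_tendsto_divide_at_top[OF tendsto_const filterlim_ident])
    moreover have "filterlim (\<lambda>j. real (d j)) at_top sequentially"
      by (rule filterlim_compose[OF filterlim_real_sequentially lim])
    ultimately have "(\<lambda>j. ln (real (d j)) / d j - ln \<delta> / d j) \<longlonglongrightarrow> 0 - 0"
      by (rule filterlim_compose)
    then have "\<forall>\<^sub>F j in sequentially. ln (real (d j)) / d j - ln \<delta> / d j < ln 2 / p"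
      by (rule order_tendstoD(2)) (use p in simp)
    then have "\<forall>\<^sub>F j in sequentially. norm (1 / (real j + 2)) \<le> (\<delta> ^ d j / fact (d j)) powr p"
    proof eventually_elim
      case (elim j)
      define m where "m = real (d j)"
      have m: "0 < m" using pos by (simp add: m_def)
      from elim have "(ln m - ln \<delta>) / m < ln 2 / p"
        by (simp add: m_def diff_divide_distrib)
      then have "p * (ln m - ln \<delta>) < m * ln 2"
        using m p by (simp add: field_simps)
      then have "m * (p * (ln m - ln \<delta>)) \<le> m * (m * ln 2)"
        using m by (intro mult_left_mono) auto
      also have "\<dots> \<le> ln (real j + 2)"
        using sq[of j] by (simp add: m_def power2_eq_square mult.assoc)
      finally have le: "- ln (real j + 2) \<le> p * (m * (ln \<delta> - ln m))"
        by (simp add: algebra_simps)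
      have "1 / (real j + 2) = exp (- ln (real j + 2))"
        by (simp add: exp_minus divide_inverse)
      also have "\<dots> \<le> exp (p * (m * (ln \<delta> - ln m)))"
        using le by simp
      also have "\<dots> = (\<delta> ^ d j / real (d j) ^ d j) powr p"
        using \<delta> pos[of j] by (simp add: powr_def ln_div ln_realpow m_def right_diff_distrib)
      also have "\<dots> \<le> (\<delta> ^ d j / fact (d j)) powr p"
      proof (intro powr_mono2 divide_left_mono)
        show "fact (d j) \<le> real (d j) ^ d j"
          using fact_le_power[of "d j", where 'a = real] by simp
      qed (use p \<delta> pos[of j] in auto)
      finally show ?case by simp
    qed
    then have "summable (\<lambda>j. 1 / (real j + 2))"
      by (rule summable_comparison_test_ev) (rule sm)
    then have "summable (\<lambda>j. 1 / real (j + 2))" by (simp add: add.commute)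
    then have "summable (\<lambda>j. 1 / real j)"
      by (subst (asm) summable_iff_shift)
    then show False using not_summable_harmonic[where 'a = real] by (simp add: divide_inverse)
  qed
  then show ?thesis using that pos lim by blast
qed

theorem mainTheorem5:
  fixes p :: real
  assumes "1 \<le> p"
  shows "(\<exists>f. entire (ell 1) (ell (ennreal p)) f \<and>
            (\<forall>m. p_compact_poly p (ell 1) (ell (ennreal p))
                   (taylor_poly (ell 1) (ell (ennreal p)) m f 0)) \<and>
            \<not> p_compact_at p (ell 1) (ell (ennreal p)) f 0) \<and>
         (\<exists>f. entire (ell 1) (ell (ennreal p)) f \<and>
            (\<forall>m. p_compact_poly p (ell 1) (ell (ennreal p))
                   (taylor_poly (ell 1) (ell (ennreal p)) m f 0)) \<and>
            (\<forall>y \<in> car (ell 1). \<forall>m.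
               p_compact_poly 1 (ell 1) (ell (ennreal p))
                 (taylor_poly (ell 1) (ell (ennreal p)) m f y) \<and>
               (\<forall>r::real. 1 \<le> r \<longrightarrow>
                  p_compact_poly r (ell 1) (ell (ennreal p))
                    (taylor_poly (ell 1) (ell (ennreal p)) m f y))) \<and>
            (\<forall>y \<in> car (ell 1). \<not> p_compact_at p (ell 1) (ell (ennreal p)) f y))"
proof -
  obtain d where d: "\<forall>j. 0 < d j" "filterlim d at_top sequentially"
    "\<forall>p \<delta>. 0 < p \<longrightarrow> 0 < \<delta> \<longrightarrow> \<not> summable (\<lambda>j. (\<delta> ^ d j / fact (d j) :: real) powr p)"
    by (rule slow_degrees)
  have zero: "0 \<in> car (ell 1)" using ell_zero[of 1] by simp
  have ent: "entire (ell 1) (ell (ennreal p)) (diag_series d)"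
    unfolding entire_def
    using diag_series_in_ell[OF assms, of d] d(1) taylor_expansion_diag_series[OF assms d(2)] by blast
  have comp: "p_compact_poly r (ell 1) (ell (ennreal p))
      (taylor_poly (ell 1) (ell (ennreal p)) m (diag_series d) y)"
    if "1 \<le> r" "y \<in> car (ell 1)" for r m y
    using d by (intro p_compact_taylor_poly_diag_series assms that) auto
  have "\<not> p_compact_at p (ell 1) (ell (ennreal p)) (diag_series d) y" for y
    using assms d(3) by (intro not_p_compact_at_diag_series) auto
  \<comment> \<open>One function witnesses both halves; the first takes \<open>r = p\<close> at the
    point 0.\<close>
  then show ?thesis
    using ent comp[OF _ zero] comp assms by (intro conjI exI[of _ "diag_series d"]) auto
qed

end
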